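(* Let $\Theta=(\theta_1,\dots,\theta_m)\in\mathbb{R}^m$. If the core map $\mathcal{C}_\Theta:\mathbf{Skew}_n\to\mathbf{Skew}_n$ is invertible, then its inverse acts blockwise: for all $N\in\mathbf{Skew}_n$ the matrix $M=\mathcal{C}_\Theta^{-1}(N)$ has blocks $M_{[i,j]}=\mathcal{C}_{[i,j]}^{-1}(N_{[i,j]})$, $i,j\le k$, with linear maps $\mathcal{C}^{-1}_{[i,j]}$ given by $$\begin{cases}\mathrm{vec}(\mathcal{C}_{[i,i]}^{-1}(N_{[i,i]}))=\mathrm{vec}(N_{[i,i]}), & i\le k,\\ \mathrm{vec}(\mathcal{C}_{[i,j]}^{-1}(N_{[i,j]}))=\mathfrak{X}(a'_{i,j},b'_{i,j},c'_{i,j},d'_{i,j})\,\mathrm{vec}(N_{[i,j]}), & j<i\le m,\\ \mathrm{vec}(\mathcal{C}_{[m+1,j]}^{-1}(N_{[m+1,j]}))=\mathfrak{Y}(r'_j,s'_j)\,\mathrm{vec}(N_{[m+1,j]}), & j\le m\ (\text{when } n=2m+1),\\ \mathcal{C}_{[m+1,m+1]}^{-1}(N_{[m+1,m+1]})=0 & (\text{when } n=2m+1),\end{cases}$$ where $$a'_{i,j}=\mathrm{cotc}\big(\tfrac{\theta_i-\theta_j}{2}\big),\quad b'_{i,j}=\tfrac{\theta_i-\theta_j}{2},\quad c'_{i,j}=\mathrm{cotc}\big(\tfrac{\theta_i+\theta_j}{2}\big),\quad d'_{i,j}=\tfrac{\theta_i+\theta_j}{2},\quad r'_j=\mathrm{cotc}\big(\tfrac{\theta_j}{2}\big),\quad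 s'_j=\tfrac{\theta_j}{2}.$$
   Context: Let $n\ge2$, $m=\lfloor n/2\rfloor$, $k=\lceil n/2\rceil$, and $\mathbf{Skew}_n=\{A\in\mathbb{R}^{n\times n}:A+A^{T}=0\}$. Block notation: the indices $1,\dots,n$ are grouped as $\{1,2\},\{3,4\},\dots,\{2m-1,2m\}$ and, if $n=2m+1$, a last group $\{n\}$. For an $n\times n$ matrix $X$, $X_{[i,j]}$ ($i,j\le k$) is the block with rows in the $i$-th group and columns in the $j$-th group; so it is $2\times2$ for $i,j\le m$, and for $n=2m+1$ (where $k=m+1$) $X_{[m+1,j]}$ is $1\times2$ and $X_{[m+1,m+1]}$ is $1\times1$. For skew-symmetric $X$, $X_{[j,i]}=-X_{[i,j]}^{T}$, so the blocks with $i<j$ are determined by those with $i>j$. $\mathrm{vec}$ stacks the columns of a matrix into a column vector (so the vec of a $1\times 2$ block is its transpose). $\mathrm{cotc}(0)=1$, and $\mathrm{cotc}(x)=x\cot(x)$ for $x$ not an integer multiple of $\pi$; $\mathrm{cotc}$ is undefined at nonzero integer multiples of $\pi$. For real numbers $a,b,c,d,r,s$: $$\mathfrak{X}(a,b,c,d)=\frac12\begin{bmatrix}a+c&-b-d&b-d&a-c\\ b+d&a+c&-a+c&b-d\\ -b+d&-a+c&a+c&-b-d\\ a-c&-b+d&b+d&a+c\end{bmatrix},\qquad \mathfrak{Y}(r,s)=\begin{bmatrix}r&-s\\ s&r\end{bmatrix}.$$ Core map: for $\Theta\in\mathbb{R}^m$ put $\lambda_{2i-1}=-\theta_i\imath$,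 $\lambda_{2i}=\theta_i\imath$ for $i\le m$, and $\lambda_n=0$ if $n=2m+1$ ($\imath$ is the imaginary unit). Let $\Phi\in\mathbb{C}^{n\times n}$ have entries $\phi_{pq}=(e^{\lambda_q-\lambda_p}-1)/(\lambda_q-\lambda_p)$ if $\lambda_p\ne\lambda_q$ and $\phi_{pq}=1$ if $\lambda_p=\lambda_q$. Let $U=\frac{\sqrt2}{2}\begin{bmatrix}1&1\\ \imath&-\imath\end{bmatrix}$ and let $U_n=\mathrm{diag}(U,\dots,U)$ ($m$ copies) if $n=2m$, $U_n=\mathrm{diag}(U,\dots,U,1)$ if $n=2m+1$. The core map is $\mathcal{C}_\Theta:\mathbf{Skew}_n\to\mathbf{Skew}_n$, $\mathcal{C}_\Theta(M)=U_n\big((U_n^{H}MU_n)\odot\Phi\big)U_n^{H}$, where $\odot$ is the entrywise (Hadamard) product and $^{H}$ the conjugate transpose. *)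

theory Defs
  imports Complex_Main "Jordan_Normal_Form.Schur_Decomposition"
begin

text \<open>Matrices are those of Jordan_Normal_Form, so all indices start at 0:
  \<open>m = n div 2\<close>, \<open>k = (n + 1) div 2\<close>, the angles are \<open>\<theta> $ 0, \<dots>, \<theta> $ (m - 1)\<close>, and the
  \<open>i\<close>-th index group (\<open>i < k\<close>) is \<open>{2 i, 2 i + 1}\<close>, cut down to \<open>{2 m}\<close> for \<open>i = m\<close>, \<open>n = 2 m + 1\<close>.\<close>

definition Skew :: "nat \<Rightarrow> real mat set" where
  "Skew n = {A \<in> carrier_mat n n. A + transpose_mat A = 0\<^sub>m n n}"

definition group_size :: "nat \<Rightarrow> nat \<Rightarrow> nat" where
  "group_size n i = min 2 (n - 2 * i)"

definition mat_block :: "nat \<Rightarrow> 'a mat \<Rightarrow> nat \<Rightarrow> nat \<Rightarrow> 'a mat" where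
  "mat_block n X i j =
     mat (group_size n i) (group_size n j) (\<lambda>(p, q). X $$ (2 * i + p, 2 * j + q))"

text \<open>Column-major stacking of the entries.\<close>

definition vec_of_mat :: "'a mat \<Rightarrow> 'a vec" where
  "vec_of_mat A = vec (dim_row A * dim_col A) (\<lambda>l. A $$ (l mod dim_row A, l div dim_row A))"

definition linear_mat_map :: "nat \<Rightarrow> nat \<Rightarrow> (real mat \<Rightarrow> real mat) \<Rightarrow> bool" where
  "linear_mat_map r c f \<longleftrightarrow>
     (\<forall>A \<in> carrier_mat r c. f A \<in> carrier_mat r c) \<and>
     (\<forall>A \<in> carrier_mat r c. \<forall>B \<in> carrier_mat r c. f (A + B) = f A + f B) \<and>
     (\<forall>x. \<forall>A \<in> carrier_mat r c. f (x \<cdot>\<^sub>m A) = x \<cdot>\<^sub>m f A)"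

text \<open>\<open>cotc\<close> is a partial function: nothing is known about its value outside \<open>cotc_dom\<close>.\<close>

definition cotc_dom :: "real set" where
  "cotc_dom = {x. x = 0 \<or> \<not> (\<exists>z :: int. x = of_int z * pi)}"

definition cotc :: "real \<Rightarrow> real" where
  "cotc x = (if x = 0 then 1 else if x \<in> cotc_dom then x * cot x else undefined)"

definition mat_X :: "real \<Rightarrow> real \<Rightarrow> real \<Rightarrow> real \<Rightarrow> real mat" where
  "mat_X a b c d = (1 / 2) \<cdot>\<^sub>m mat_of_rows_list 4
     [[ a + c, - b - d,   b - d,   a - c],
      [ b + d,   a + c, - a + c,   b - d],
      [- b + d, - a + c,  a + c, - b - d],
      [ a - c, - b + d,   b + d,   a + c]]"

definition mat_Y :: "real \<Rightarrow> real \<Rightarrow> real mat" where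
  "mat_Y r s = mat_of_rows_list 2 [[r, - s], [s, r]]"

definition core_eig :: "nat \<Rightarrow> real vec \<Rightarrow> nat \<Rightarrow> complex" where
  "core_eig n \<theta> p =
     (if p < 2 * (n div 2)
      then (if even p then - (complex_of_real (\<theta> $ (p div 2)) * \<i>)
            else complex_of_real (\<theta> $ (p div 2)) * \<i>)
      else 0)"

definition core_Phi :: "nat \<Rightarrow> real vec \<Rightarrow> complex mat" where
  "core_Phi n \<theta> = mat n n (\<lambda>(p, q).
     if core_eig n \<theta> p \<noteq> core_eig n \<theta> q
     then (exp (core_eig n \<theta> q - core_eig n \<theta> p) - 1) / (core_eig n \<theta> q - core_eig n \<theta> p)
     else 1)"

definition core_U2 :: "complex mat" where
  "core_U2 = complex_of_real (sqrt 2 / 2) \<cdot>\<^sub>m mat_of_rows_list 2 [[1, 1], [\<i>, - \<i>]]"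

definition core_U :: "nat \<Rightarrow> complex mat" where
  "core_U n = diag_block_mat (replicate (n div 2) core_U2 @ (if odd n then [1\<^sub>m 1] else []))"

definition hadamard_prod :: "'a :: times mat \<Rightarrow> 'a mat \<Rightarrow> 'a mat" where
  "hadamard_prod A B = mat (dim_row A) (dim_col A) (\<lambda>(p, q). A $$ (p, q) * B $$ (p, q))"

definition core_map_complex :: "nat \<Rightarrow> real vec \<Rightarrow> complex mat \<Rightarrow> complex mat" where
  "core_map_complex n \<theta> M =
     core_U n * hadamard_prod (mat_adjoint (core_U n) * M * core_U n) (core_Phi n \<theta>)
       * mat_adjoint (core_U n)"

text \<open>On skew-symmetric real matrices the formula above only produces real entries
  (\<open>core_map_complex_eq\<close>), so taking real parts is just the inverse of the embedding of the
  real into the complex matrices.\<close>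

definition core_map :: "nat \<Rightarrow> real vec \<Rightarrow> real mat \<Rightarrow> real mat" where
  "core_map n \<theta> M = map_mat Re (core_map_complex n \<theta> (map_mat complex_of_real M))"

lemma core_U2_dims [simp]: "dim_row core_U2 = 2" "dim_col core_U2 = 2"
  by (simp_all add: core_U2_def mat_of_rows_list_def)


lemma diag_block_core_U2:
  fixes R :: "complex mat list"
  assumes R: "R = [] \<or> R = [1\<^sub>m 1]"
  defines "D \<equiv> \<lambda>m. diag_block_mat (replicate m core_U2 @ R)"
  shows "dim_row (D m) = 2 * m + length R" (is ?A)
    and "dim_col (D m) = 2 * m + length R" (is ?B)
    and "p < 2 * m + length R \<Longrightarrow> q < 2 * m + length R \<Longrightarrow>
      D m $$ (p, q) =
        (if p div 2 = q div 2 then if p < 2 * m then core_U2 $$ (p mod 2, q mod 2) else 1 else 0)"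
proof -
  have dims: "dim_row (D m) = 2 * m + length R \<and> dim_col (D m) = 2 * m + length R" for m
    unfolding D_def using R by (induction m) (auto simp: Let_def)
  show ?A ?B using dims by auto
  show "D m $$ (p, q) =
        (if p div 2 = q div 2 then if p < 2 * m then core_U2 $$ (p mod 2, q mod 2) else 1 else 0)"
    if "p < 2 * m + length R" "q < 2 * m + length R"
    using that
  proof (induction m arbitrary: p q)
    case 0
    then show ?case using R by (auto simp: D_def)
  next
    case (Suc m)
    have D: "D (Suc m) = four_block_mat core_U2 (0\<^sub>m 2 (dim_col (D m))) (0\<^sub>m (dim_row (D m)) 2) (D m)"
      by (simp add: D_def Let_def)
    show ?case
    proof (cases "p < 2 \<or> q < 2")
      case True
      then show ?thesis unfolding D using Suc.prems dims[of m] by (auto simp: div_eq_0_iff)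
    next
      case False
      then have pq: "p \<ge> 2" "q \<ge> 2" by auto
      have e: "D (Suc m) $$ (p, q) = D m $$ (p - 2, q - 2)"
        unfolding D using Suc.prems dims[of m] pq by auto
      obtain a b where "p = a + 2" "q = b + 2" using pq by (metis add.commute le_Suc_ex)
      then show ?thesis unfolding e using Suc.IH[of a b] Suc.prems by simp
    qed
  qed
qed

lemma core_U_carrier: "core_U n \<in> carrier_mat n n"
proof -
  have "2 * (n div 2) + (if odd n then 1 else 0) = n" by auto
  then show ?thesis
    using diag_block_core_U2(1,2)[of "if odd n then [1\<^sub>m 1] else []" "n div 2"]
    by (auto simp: core_U_def)
qed

lemma core_U_index:
  assumes "p < n" "q < n"
  shows "core_U n $$ (p, q) =
    (if p div 2 = q div 2
     then if p < 2 * (n div 2) then core_U2 $$ (p mod 2, q mod 2) else 1 else 0)"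
proof -
  have "2 * (n div 2) + (if odd n then 1 else 0) = n" by auto
  then show ?thesis
    using diag_block_core_U2(3)[of "if odd n then [1\<^sub>m 1] else []" p "n div 2" q] assms
    by (auto simp: core_U_def split: if_splits)
qed

text \<open>\<open>group_swap\<close> exchanges the two indices of every complete group.\<close>

definition group_swap :: "nat \<Rightarrow> nat \<Rightarrow> nat" where
  "group_swap n p = (if p < 2 * (n div 2) then if even p then p + 1 else p - 1 else p)"

lemma group_swap_less: "p < n \<Longrightarrow> group_swap n p < n"
  by (auto simp: group_swap_def elim!: evenE oddE)

lemma group_swap_group_swap [simp]: "group_swap n (group_swap n p) = p"
  by (auto simp: group_swap_def elim!: evenE oddE)

lemma group_swap_div: "group_swap n p div 2 = p div 2"
  by (auto simp: group_swap_def elim!: evenE oddE)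

lemma sum_group_swap: "(\<Sum>a<n. f (group_swap n a)) = (\<Sum>a<n. f a)"
  by (rule sum.reindex_bij_witness[of _ "group_swap n" "group_swap n"]) (auto simp: group_swap_less)

lemma cnj_core_U:
  assumes "p < n" "q < n"
  shows "cnj (core_U n $$ (p, q)) = core_U n $$ (p, group_swap n q)"
proof -
  have p2: "p mod 2 = 0 \<or> p mod 2 = Suc 0" "q mod 2 = 0 \<or> q mod 2 = Suc 0" by auto
  have lt: "r < 2 * (n div 2) \<longleftrightarrow> r div 2 < n div 2" for r
    by (simp add: div_less_iff_less_mult mult.commute)
  have m: "group_swap n q mod 2 = 1 - q mod 2" if "q < 2 * (n div 2)"
  proof (cases "even q")
    case True
    then show ?thesis using that by (auto simp: group_swap_def elim: evenE)
  next
    case False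
    then show ?thesis using that by (auto simp: group_swap_def elim: oddE)
  qed
  show ?thesis
  proof (cases "p div 2 = q div 2 \<and> p < 2 * (n div 2)")
    case True
    then have "q < 2 * (n div 2)" using lt[of p] lt[of q] by simp
    then have e: "core_U n $$ (p, q) = core_U2 $$ (p mod 2, q mod 2)"
      "core_U n $$ (p, group_swap n q) = core_U2 $$ (p mod 2, 1 - q mod 2)"
      using True assms group_swap_less[of q n] m by (simp_all add: core_U_index group_swap_div)
    show ?thesis
      unfolding e using p2 by (elim disjE) (simp_all add: core_U2_def mat_of_rows_list_def)
  next
    case False
    then show ?thesis
      using assms group_swap_less[of q n] by (auto simp: core_U_index group_swap_div)
  qed
qed

lemma core_eig_swap: "core_eig n \<theta> (group_swap n p) = cnj (core_eig n \<theta> p)"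
proof -
  have "even (group_swap n p) = odd p \<and> group_swap n p < 2 * (n div 2)" if "p < 2 * (n div 2)"
    using that by (auto simp: group_swap_def elim!: evenE oddE)
  then show ?thesis
    using group_swap_div[of n p] by (auto simp: core_eig_def group_swap_def)
qed

lemma cnj_core_eig: "cnj (core_eig n \<theta> p) = - core_eig n \<theta> p"
  by (simp add: core_eig_def)

lemma cnj_exp_eq: "cnj (exp z) = exp (cnj z)"
  by (simp add: complex_eq_iff Re_exp Im_exp)

lemma core_Phi_swap:
  assumes "p < n" "q < n"
  shows "core_Phi n \<theta> $$ (group_swap n p, group_swap n q) = cnj (core_Phi n \<theta> $$ (p, q))"
  using assms by (simp add: core_Phi_def group_swap_less core_eig_swap cnj_exp_eq)

lemma core_Phi_hermitian:
  assumes "p < n" "q < n"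
  shows "core_Phi n \<theta> $$ (q, p) = cnj (core_Phi n \<theta> $$ (p, q))"
  using assms by (auto simp: core_Phi_def cnj_exp_eq cnj_core_eig)

lemma core_map_complex_carrier: "core_map_complex n \<theta> M \<in> carrier_mat n n"
  using core_U_carrier[of n] by (auto simp: core_map_complex_def mat_adjoint_def)

lemma core_map_complex_index:
  fixes n :: nat
  assumes M: "M \<in> carrier_mat n n" and pq: "p < n" "q < n"
  defines "u \<equiv> \<lambda>p q. core_U n $$ (p, q)"
  shows "core_map_complex n \<theta> M $$ (p, q) =
    (\<Sum>b<n. \<Sum>a<n. u p a *
       ((\<Sum>d<n. \<Sum>c<n. cnj (u c a) * M $$ (c, d) * u d b) * core_Phi n \<theta> $$ (a, b)) * cnj (u q b))"
proof -
  have U: "core_U n \<in> carrier_mat n n" by (rule core_U_carrier)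
  have prod: "(A * B) $$ (i, j) = (\<Sum>l<n. A $$ (i, l) * B $$ (l, j))"
    if "A \<in> carrier_mat n n" "B \<in> carrier_mat n n" "i < n" "j < n" for A B :: "complex mat" and i j
    using that by (auto simp: scalar_prod_def lessThan_atLeast0 intro!: sum.cong)
  have AU: "mat_adjoint (core_U n) \<in> carrier_mat n n"
    using U by (auto simp: mat_adjoint_def)
  have ai: "mat_adjoint (core_U n) $$ (i, j) = cnj (u j i)" if "i < n" "j < n" for i j
    using U that by (auto simp: mat_adjoint_def mat_of_rows_index u_def)
  define F where "F = mat_adjoint (core_U n) * M * core_U n"
  have Fc: "F \<in> carrier_mat n n" using U AU M by (auto simp: F_def)
  have F: "F $$ (i, j) = (\<Sum>d<n. \<Sum>c<n. cnj (u c i) * M $$ (c, d) * u d j)" if "i < n" "j < n" for i j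
    unfolding F_def using U AU M that
    by (subst prod) (auto simp: prod ai sum_distrib_right u_def intro!: sum.cong simp del: index_mult_mat(1))
  define G where "G = hadamard_prod F (core_Phi n \<theta>)"
  have Gc: "G \<in> carrier_mat n n" using Fc by (auto simp: G_def hadamard_prod_def)
  have G: "G $$ (i, j) = F $$ (i, j) * core_Phi n \<theta> $$ (i, j)" if "i < n" "j < n" for i j
    using that Fc by (auto simp: G_def hadamard_prod_def)
  have "(core_U n * G * mat_adjoint (core_U n)) $$ (p, q) =
    (\<Sum>b<n. \<Sum>a<n. u p a * G $$ (a, b) * cnj (u q b))"
    using U AU Gc pq
    by (subst prod) (auto simp: prod ai sum_distrib_right u_def intro!: sum.cong simp del: index_mult_mat(1))
  then show ?thesis
    unfolding core_map_complex_def F_def[symmetric] G_def[symmetric]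
    by (simp add: F G)
qed

lemma Skew_iff: "M \<in> Skew n \<longleftrightarrow>
  M \<in> carrier_mat n n \<and> (\<forall>p<n. \<forall>q<n. M $$ (q, p) = - M $$ (p, q))"
proof -
  have "M + transpose_mat M = 0\<^sub>m n n \<longleftrightarrow> (\<forall>p<n. \<forall>q<n. M $$ (q, p) = - M $$ (p, q))"
    if "M \<in> carrier_mat n n"
    using that by (auto simp: mat_eq_iff add_eq_0_iff)
  then show ?thesis by (auto simp: Skew_def)
qed

lemma core_map_complex_cnj:
  assumes M: "M \<in> carrier_mat n n" and pq: "p < n" "q < n"
  defines "M' \<equiv> map_mat complex_of_real M"
  shows "cnj (core_map_complex n \<theta> M' $$ (p, q)) = core_map_complex n \<theta> M' $$ (p, q)"
proof -
  have M': "M' \<in> carrier_mat n n" using M by (auto simp: M'_def)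
  have cM: "cnj (M' $$ (c, d)) = M' $$ (c, d)" if "c < n" "d < n" for c d
    using M that by (auto simp: M'_def)
  let ?u = "\<lambda>p q. core_U n $$ (p, q)"
  define F where "F a b = (\<Sum>d<n. \<Sum>c<n. cnj (?u c a) * M' $$ (c, d) * ?u d b)" for a b
  have F: "cnj (F a b) = F (group_swap n a) (group_swap n b)" if "a < n" "b < n" for a b
    unfolding F_def using that cM
    by (auto simp: cnj_sum cnj_core_U group_swap_less intro!: sum.cong)
  define T where "T a b = ?u p a * (F a b * core_Phi n \<theta> $$ (a, b)) * cnj (?u q b)" for a b
  have T: "cnj (T a b) = T (group_swap n a) (group_swap n b)" if "a < n" "b < n" for a b
    unfolding T_def using that pq
    by (simp add: F cnj_core_U group_swap_less core_Phi_swap)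
  have "cnj (\<Sum>b<n. \<Sum>a<n. T a b) = (\<Sum>b<n. \<Sum>a<n. T (group_swap n a) (group_swap n b))"
    by (simp add: cnj_sum T)
  also have "\<dots> = (\<Sum>b<n. \<Sum>a<n. T a (group_swap n b))"
    by (rule sum.cong[OF refl]) (rule sum_group_swap)
  also have "\<dots> = (\<Sum>b<n. \<Sum>a<n. T a b)"
    by (rule sum_group_swap[of "\<lambda>b. \<Sum>a<n. T a b"])
  finally show ?thesis
    using core_map_complex_index[OF M' pq, of \<theta>] by (simp add: T_def F_def)
qed

lemma core_map_complex_skew:
  assumes M: "M \<in> Skew n" and pq: "p < n" "q < n"
  defines "M' \<equiv> map_mat complex_of_real M"
  shows "core_map_complex n \<theta> M' $$ (q, p) = - cnj (core_map_complex n \<theta> M' $$ (p, q))"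
proof -
  have Mc: "M \<in> carrier_mat n n" using M unfolding Skew_def by blast
  have M': "M' \<in> carrier_mat n n" using Mc by (auto simp: M'_def)
  have sM: "cnj (M' $$ (c, d)) = - M' $$ (d, c)" if "c < n" "d < n" for c d
  proof -
    have "M $$ (d, c) = - M $$ (c, d)" using M that unfolding Skew_iff by blast
    then have "complex_of_real (M $$ (c, d)) = - complex_of_real (M $$ (d, c))" by simp
    then show ?thesis using Mc that by (simp add: M'_def)
  qed
  let ?u = "\<lambda>p q. core_U n $$ (p, q)"
  define F where "F a b = (\<Sum>d<n. \<Sum>c<n. cnj (?u c a) * M' $$ (c, d) * ?u d b)" for a b
  have F: "cnj (F a b) = - F b a" if "a < n" "b < n" for a b
  proof -
    have "cnj (F a b) = (\<Sum>d<n. \<Sum>c<n. - (cnj (?u d b) * M' $$ (d, c) * ?u c a))"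
      unfolding F_def by (auto simp: cnj_sum sM mult.assoc mult.left_commute intro!: sum.cong)
    also have "\<dots> = (\<Sum>c<n. \<Sum>d<n. - (cnj (?u d b) * M' $$ (d, c) * ?u c a))"
      by (rule sum.swap)
    finally show ?thesis by (simp add: F_def sum_negf)
  qed
  define T where "T p q a b = ?u p a * (F a b * core_Phi n \<theta> $$ (a, b)) * cnj (?u q b)" for p q a b
  have T: "cnj (T p q a b) = - T q p b a" if "a < n" "b < n" for a b
    unfolding T_def using that F[OF that] core_Phi_hermitian[OF that(2,1), of \<theta>] by simp
  have "cnj (\<Sum>b<n. \<Sum>a<n. T p q a b) = (\<Sum>b<n. \<Sum>a<n. - T q p b a)"
    by (simp add: cnj_sum T)
  also have "\<dots> = (\<Sum>a<n. \<Sum>b<n. - T q p b a)"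
    by (rule sum.swap)
  also have "\<dots> = - (\<Sum>b<n. \<Sum>a<n. T q p a b)"
    by (simp add: sum_negf)
  finally show ?thesis
    using core_map_complex_index[OF M' pq, of \<theta>] core_map_complex_index[OF M' pq(2,1), of \<theta>]
    by (simp add: T_def F_def)
qed

lemma core_map_complex_eq:
  assumes "M \<in> Skew n"
  shows "core_map_complex n \<theta> (map_mat complex_of_real M) = map_mat complex_of_real (core_map n \<theta> M)"
proof -
  have M: "M \<in> carrier_mat n n" using assms unfolding Skew_def by blast
  note c = core_map_complex_carrier[of n \<theta> "map_mat complex_of_real M"]
  show ?thesis
    using c core_map_complex_cnj[OF M, of _ _ \<theta>]
    by (intro eq_matI) (auto simp: core_map_def complex_eq_iff)
qed

lemma core_map_Skew:
  assumes "M \<in> Skew n"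
  shows "core_map n \<theta> M \<in> Skew n"
proof -
  note c = core_map_complex_carrier[of n \<theta> "map_mat complex_of_real M"]
  have "core_map n \<theta> M $$ (q, p) = - core_map n \<theta> M $$ (p, q)" if "p < n" "q < n" for p q
    using c that arg_cong[OF core_map_complex_skew[OF assms that, of \<theta>], of Re]
    by (simp add: core_map_def)
  moreover have "core_map n \<theta> M \<in> carrier_mat n n"
    using c by (simp add: core_map_def)
  ultimately show ?thesis unfolding Skew_iff by blast
qed

end

theory Submission
  imports Defs
begin

text \<open>Conjugating the Hadamard product by \<open>core_U n\<close> gives \<open>C = f(D)\<close> with
  \<open>f(z) = (exp z - 1) / z\<close> and \<open>D X = X S - S X\<close>, where \<open>S\<close> is block diagonal with blocks
  \<open>\<theta>\<^sub>i J\<close>, \<open>J = [0, -1; 1, 0]\<close>. Hence \<open>C\<close> acts on each block separately. A 2x2 block splits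
  into a part commuting and a part anticommuting with \<open>J\<close>, each of which is a complex line (with
  \<open>J\<close> as imaginary unit), and \<open>C\<close> multiplies them by the conjugates of
  \<open>f(\<i> (\<theta>\<^sub>i - \<theta>\<^sub>j))\<close> and \<open>f(\<i> (\<theta>\<^sub>i + \<theta>\<^sub>j))\<close>; the matrix of such a pair of multiplications is
  \<open>mat_X\<close>. If one of these numbers vanishes, the image misses part of the block, so surjectivity
  puts the half angles into \<open>cotc_dom\<close>, and there \<open>1 / f(\<i> y) = cotc (y / 2) - \<i> y / 2\<close>.\<close>

section \<open>The multiplier f(\<i> y) and its reciprocal\<close>

definition expc :: "real \<Rightarrow> complex" where
  "expc y = (if y = 0 then 1 else (exp (\<i> * y) - 1) / (\<i> * y))"

lemma cnj_expc: "cnj (expc y) = expc (- y)"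
  by (simp add: expc_def cnj_exp_eq)

text \<open>Pulling out the phase of the half angle leaves a sine of the half angle. The zeros of
  \<open>expc\<close> and its reciprocal are read off from this form, which is where all the half
  angles of the result come from.\<close>

lemma exp_minus_1_half: "exp (\<i> * y) - 1 = 2 * \<i> * sin (y / 2) * exp (\<i> * (y / 2))" for y :: real
proof -
  have c: "cos y = 1 - 2 * (sin (y / 2))\<^sup>2" and s: "sin y = 2 * sin (y / 2) * cos (y / 2)"
    using cos_double_sin[of "y / 2"] sin_double[of "y / 2"] by simp_all
  show ?thesis
    by (simp add: complex_eq_iff Re_exp Im_exp c s power2_eq_square)
qed

lemma notin_cotc_dom_iff: "x \<notin> cotc_dom \<longleftrightarrow> x \<noteq> 0 \<and> sin x = 0"
  by (auto simp: cotc_dom_def sin_zero_iff_int2)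

lemma expc_eq_0: "y / 2 \<notin> cotc_dom \<Longrightarrow> expc y = 0"
  by (simp add: notin_cotc_dom_iff expc_def exp_minus_1_half)

lemma expc_inverse:
  assumes "y / 2 \<in> cotc_dom"
  shows "expc y * Complex (cotc (y / 2)) (- (y / 2)) = 1"
proof (cases "y = 0")
  case True
  then show ?thesis by (simp add: expc_def cotc_def complex_eq_iff)
next
  case False
  then have s: "sin (y / 2) \<noteq> 0" using assms notin_cotc_dom_iff[of "y / 2"] by simp
  \<comment> \<open>With x = y / 2 this is x (cot x - \<i>) = x exp(- \<i> x) / sin x, the
    reciprocal of the factored form sin x exp(\<i> x) / x of \<open>expc y\<close>.\<close>
  have "Complex (cotc (y / 2)) (- (y / 2)) = (y / 2) * exp (- (\<i> * (y / 2))) / sin (y / 2)"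
    using False assms s
    by (simp add: cotc_def cot_def complex_eq_iff Re_exp Im_exp Re_divide_of_real Im_divide_of_real)
  then show ?thesis
    using False s unfolding expc_def exp_minus_1_half
    by (simp add: exp_minus field_simps)
qed

text \<open>The eigenvalues are purely imaginary, and two of them coincide exactly when y = 0, so
  the case split of \<open>core_Phi\<close> is that of \<open>expc\<close>. Coinciding eigenvalues
  then need no separate treatment.\<close>

lemma core_Phi_expc:
  assumes "p < n" "q < n" "core_eig n \<theta> q - core_eig n \<theta> p = \<i> * y"
  shows "core_Phi n \<theta> $$ (p, q) = expc y"
  using assms by (auto simp: core_Phi_def expc_def)

section \<open>Restriction of the core map to a pair of index groups\<close>

lemma sum_group:
  fixes f :: "nat \<Rightarrow> 'a :: comm_monoid_add"
  assumes "2 * i < n" and "\<And>a. a < n \<Longrightarrow> a div 2 \<noteq> i \<Longrightarrow> f a = 0"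
  shows "(\<Sum>a<n. f a) = (\<Sum>r<group_size n i. f (2 * i + r))"
proof -
  have "(\<Sum>r<group_size n i. f (2 * i + r)) = sum f ((+) (2 * i) ` {..<group_size n i})"
    by (subst sum.reindex) (auto intro: inj_onI)
  also have "\<dots> = (\<Sum>a<n. f a)"
  proof (rule sum.mono_neutral_left)
    show "\<forall>a\<in>{..<n} - (+) (2 * i) ` {..<group_size n i}. f a = 0"
    proof
      fix a assume a: "a \<in> {..<n} - (+) (2 * i) ` {..<group_size n i}"
      have "a div 2 \<noteq> i"
      proof
        assume "a div 2 = i"
        then have "a = 2 * i + a mod 2" by auto
        moreover have "a mod 2 < group_size n i"
          using a \<open>a = 2 * i + a mod 2\<close> by (auto simp: group_size_def)
        ultimately show False using a by blast
      qed
      then show "f a = 0" using assms(2) a by auto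
    qed
  qed (auto simp: group_size_def)
  finally show ?thesis by simp
qed

text \<open>Entries of \<open>core_U n\<close> between different groups vanish, so by
  \<open>sum_group\<close> each of the four sums in \<open>core_map_complex_index\<close> collapses
  to one group. Hence a block of the image depends only on the block of M at the same place.\<close>

lemma core_map_complex_block:
  fixes n i j :: nat
  assumes M: "M \<in> carrier_mat n n" and ij: "2 * i < n" "2 * j < n"
    and p: "p < group_size n i" and q: "q < group_size n j"
  defines "u \<equiv> \<lambda>p q. core_U n $$ (p, q)"
  shows "core_map_complex n \<theta> M $$ (2 * i + p, 2 * j + q) =
    (\<Sum>b<group_size n j. \<Sum>a<group_size n i. u (2 * i + p) (2 * i + a) *
       ((\<Sum>d<group_size n j. \<Sum>c<group_size n i.
           cnj (u (2 * i + c) (2 * i + a)) * M $$ (2 * i + c, 2 * j + d) * u (2 * j + d) (2 * j + b))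
         * core_Phi n \<theta> $$ (2 * i + a, 2 * j + b)) * cnj (u (2 * j + q) (2 * j + b)))"
proof -
  have less: "2 * i' + r < n" "(2 * i' + r) div 2 = i'" if "r < group_size n i'" for i' r
    using that by (auto simp: group_size_def)
  have u0: "u a b = 0" if "a < n" "b < n" "a div 2 \<noteq> b div 2" for a b
    using that by (simp add: u_def core_U_index)
  define F where "F a b = (\<Sum>d<n. \<Sum>c<n. cnj (u c a) * M $$ (c, d) * u d b)" for a b
  have F: "F (2 * i + a) (2 * j + b) = (\<Sum>d<group_size n j. \<Sum>c<group_size n i.
      cnj (u (2 * i + c) (2 * i + a)) * M $$ (2 * i + c, 2 * j + d) * u (2 * j + d) (2 * j + b))"
    if "a < group_size n i" "b < group_size n j" for a b
  proof -
    have "F (2 * i + a) (2 * j + b) = (\<Sum>d<group_size n j. \<Sum>c<n.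
      cnj (u c (2 * i + a)) * M $$ (c, 2 * j + d) * u (2 * j + d) (2 * j + b))"
      unfolding F_def using that less by (subst sum_group[OF ij(2)]) (auto simp: u0)
    also have "\<dots> = (\<Sum>d<group_size n j. \<Sum>c<group_size n i.
      cnj (u (2 * i + c) (2 * i + a)) * M $$ (2 * i + c, 2 * j + d) * u (2 * j + d) (2 * j + b))"
      using that less by (intro sum.cong[OF refl] sum_group[OF ij(1)]) (auto simp: u0)
    finally show ?thesis .
  qed
  have "core_map_complex n \<theta> M $$ (2 * i + p, 2 * j + q) =
    (\<Sum>b<n. \<Sum>a<n. u (2 * i + p) a * (F a b * core_Phi n \<theta> $$ (a, b)) * cnj (u (2 * j + q) b))"
    unfolding F_def u_def using M less(1)[OF p] less(1)[OF q] by (rule core_map_complex_index)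
  also have "\<dots> = (\<Sum>b<group_size n j. \<Sum>a<n. u (2 * i + p) a *
      (F a (2 * j + b) * core_Phi n \<theta> $$ (a, 2 * j + b)) * cnj (u (2 * j + q) (2 * j + b)))"
    using p q less by (subst sum_group[OF ij(2)]) (auto simp: u0)
  also have "\<dots> = (\<Sum>b<group_size n j. \<Sum>a<group_size n i. u (2 * i + p) (2 * i + a) *
      (F (2 * i + a) (2 * j + b) * core_Phi n \<theta> $$ (2 * i + a, 2 * j + b))
        * cnj (u (2 * j + q) (2 * j + b)))"
    using p q less by (intro sum.cong[OF refl] sum_group[OF ij(1)]) (auto simp: u0)
  also have "\<dots> = (\<Sum>b<group_size n j. \<Sum>a<group_size n i. u (2 * i + p) (2 * i + a) *
       ((\<Sum>d<group_size n j. \<Sum>c<group_size n i.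
           cnj (u (2 * i + c) (2 * i + a)) * M $$ (2 * i + c, 2 * j + d) * u (2 * j + d) (2 * j + b))
         * core_Phi n \<theta> $$ (2 * i + a, 2 * j + b)) * cnj (u (2 * j + q) (2 * j + b)))"
    by (intro sum.cong refl) (simp add: F)
  finally show ?thesis .
qed

section \<open>Vectorised blocks and the algebra of \<open>mat_X\<close> and
  \<open>mat_Y\<close>\<close>

lemma group_size_full: "i < n div 2 \<Longrightarrow> group_size n i = 2"
  by (auto simp: group_size_def)

lemma group_size_last: "odd n \<Longrightarrow> group_size n (n div 2) = 1"
  by (auto simp: group_size_def elim: oddE)

lemma vec_of_mat_block_full:
  assumes "i < n div 2" "j < n div 2"
  shows "vec_of_mat (mat_block n X i j) =
    vec_of_list [X $$ (2 * i, 2 * j), X $$ (2 * i + 1, 2 * j),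
      X $$ (2 * i, 2 * j + 1), X $$ (2 * i + 1, 2 * j + 1)]"
  using assms
  by (intro eq_vecI) (auto simp: vec_of_mat_def mat_block_def group_size_full less_Suc_eq)

lemma vec_of_mat_block_last:
  assumes "odd n" "j < n div 2"
  shows "vec_of_mat (mat_block n X (n div 2) j) =
    vec_of_list [X $$ (2 * (n div 2), 2 * j), X $$ (2 * (n div 2), 2 * j + 1)]"
  using assms
  by (intro eq_vecI)
     (auto simp: vec_of_mat_def mat_block_def group_size_full group_size_last less_Suc_eq)

lemma mat_X_mult_vec:
  "mat_X a b c d *\<^sub>v vec_of_list [x, y, z, w] = vec_of_list
    [((a + c) * x - (b + d) * y + (b - d) * z + (a - c) * w) / 2,
     ((b + d) * x + (a + c) * y + (c - a) * z + (b - d) * w) / 2,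
     ((d - b) * x + (c - a) * y + (a + c) * z - (b + d) * w) / 2,
     ((a - c) * x + (d - b) * y + (b + d) * z + (a + c) * w) / 2]"
  by (intro eq_vecI)
     (auto simp: mat_X_def mat_of_rows_list_def scalar_prod_def less_Suc_eq eval_nat_numeral field_simps)

lemma mat_Y_mult_vec:
  "mat_Y r s *\<^sub>v vec_of_list [x, y] = vec_of_list [r * x - s * y, s * x + r * y]"
  by (intro eq_vecI)
     (auto simp: mat_Y_def mat_of_rows_list_def scalar_prod_def less_Suc_eq eval_nat_numeral field_simps)

text \<open>The premises say that u' + \<i> v' is the product of a' + \<i> b' and u + \<i> v;
  multiplying by the reciprocal a + \<i> b recovers u + \<i> v. \<open>mat_Y\<close> uses this once,
  \<open>mat_X\<close> once for each of its two parts.\<close>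

lemma complex_inverse_parts:
  assumes "Complex a b * Complex a' b' = 1" "u' = a' * u - b' * v" "v' = b' * u + a' * v"
  shows "a * u' - b * v' = u" "b * u' + a * v' = v"
proof -
  have "Complex u' v' = Complex a' b' * Complex u v"
    using assms(2,3) by (simp add: complex_eq_iff)
  then have "Complex a b * Complex u' v' = Complex u v"
    using assms(1) by (simp flip: mult.assoc)
  then show "a * u' - b * v' = u" "b * u' + a * v' = v"
    by (simp_all add: complex_eq_iff)
qed

lemma mat_X_inverse:
  assumes "Complex a b * Complex a' b' = 1" "Complex c d * Complex c' d' = 1"
    and v: "v = vec_of_list [x, y, z, w]"
  shows "mat_X a b c d *\<^sub>v (mat_X a' b' c' d' *\<^sub>v v) = v"
proof -
  txt \<open>The commuting part has coordinates \<open>(x + w, y - z)\<close>, the anticommuting part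
    \<open>(x - w, y + z)\<close>.\<close>
  define x' where "x' = ((a' + c') * x - (b' + d') * y + (b' - d') * z + (a' - c') * w) / 2"
  define y' where "y' = ((b' + d') * x + (a' + c') * y + (c' - a') * z + (b' - d') * w) / 2"
  define z' where "z' = ((d' - b') * x + (c' - a') * y + (a' + c') * z - (b' + d') * w) / 2"
  define w' where "w' = ((a' - c') * x + (d' - b') * y + (b' + d') * z + (a' + c') * w) / 2"
  \<comment> \<open>In these coordinates \<open>mat_X\<close> multiplies the commuting part by a' +
    \<i> b' and the anticommuting part by c' + \<i> d'.\<close>
  have e: "x' + w' = a' * (x + w) - b' * (y - z)" "y' - z' = b' * (x + w) + a' * (y - z)"
    "x' - w' = c' * (x - w) - d' * (y + z)" "y' + z' = d' * (x - w) + c' * (y + z)"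
    by (simp_all add: x'_def y'_def z'_def w'_def field_simps)
  have "a * (x' + w') - b * (y' - z') = x + w" "b * (x' + w') + a * (y' - z') = y - z"
    "c * (x' - w') - d * (y' + z') = x - w" "d * (x' - w') + c * (y' + z') = y + z"
    by (rule complex_inverse_parts[OF assms(1) e(1,2)] complex_inverse_parts[OF assms(2) e(3,4)])+
  then have "((a + c) * x' - (b + d) * y' + (b - d) * z' + (a - c) * w') / 2 = x"
    "((b + d) * x' + (a + c) * y' + (c - a) * z' + (b - d) * w') / 2 = y"
    "((d - b) * x' + (c - a) * y' + (a + c) * z' - (b + d) * w') / 2 = z"
    "((a - c) * x' + (d - b) * y' + (b + d) * z' + (a + c) * w') / 2 = w"
    by (simp_all add: algebra_simps)
  then show ?thesis
    unfolding v mat_X_mult_vec x'_def[symmetric] y'_def[symmetric] z'_def[symmetric] w'_def[symmetric]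
    by simp
qed

lemma mat_Y_inverse:
  assumes "Complex a b * Complex a' b' = 1" and v: "v = vec_of_list [x, y]"
  shows "mat_Y a b *\<^sub>v (mat_Y a' b' *\<^sub>v v) = v"
  using complex_inverse_parts[OF assms(1) refl refl, of x y]
  unfolding v mat_Y_mult_vec by simp

section \<open>The core map on a single block\<close>

lemma core_eig_pair:
  assumes "i < n div 2"
  shows "core_eig n \<theta> (2 * i) = - (\<theta> $ i * \<i>)" "core_eig n \<theta> (Suc (2 * i)) = \<theta> $ i * \<i>"
  using assms by (auto simp: core_eig_def)

text \<open>The entries of \<open>core_U2\<close> without the normalising factor.\<close>

definition pair_coeff :: "nat \<Rightarrow> nat \<Rightarrow> complex" where
  "pair_coeff p a = (if p = 0 then 1 else if a = 0 then \<i> else - \<i>)"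

lemma core_U_pair:
  assumes "i < n div 2" "p < 2" "a < 2"
  shows "core_U n $$ (2 * i + p, 2 * i + a) = complex_of_real (sqrt 2 / 2) * pair_coeff p a"
  using assms
  by (auto simp: core_U_index core_U2_def mat_of_rows_list_def pair_coeff_def less_2_cases_iff)

lemma sqrt2_half_squared:
  "complex_of_real (sqrt 2 / 2) * complex_of_real (sqrt 2 / 2) = 1 / 2"
  by (simp flip: of_real_mult)

text \<open>The four factors from \<open>core_U n\<close> contribute sqrt 2 / 2 each, and their
  product is the 1 / 4.\<close>

lemma core_map_complex_pair:
  fixes \<theta> :: "real vec"
  assumes M: "M \<in> carrier_mat n n" and ij: "i < n div 2" "j < n div 2" and pq: "p < 2" "q < 2"
  shows "core_map_complex n \<theta> M $$ (2 * i + p, 2 * j + q) =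
    (\<Sum>b<2. \<Sum>a<2. pair_coeff p a *
       ((\<Sum>d<2. \<Sum>c<2. cnj (pair_coeff c a) * M $$ (2 * i + c, 2 * j + d) * pair_coeff d b)
         * core_Phi n \<theta> $$ (2 * i + a, 2 * j + b)) * cnj (pair_coeff q b)) / 4"
proof -
  define s where "s = complex_of_real (sqrt 2 / 2)"
  have s: "s * s = 1 / 2" "cnj s = s" unfolding s_def by (rule sqrt2_half_squared) simp
  have inner: "cnj (s * x) * m * (s * y) = (cnj x * m * y) / 2" for x m y
    using s by (simp add: field_simps)
  have outer: "s * x * (f / 2 * g) * cnj (s * y) = x * (f * g) * cnj y / 4" for x f g y
    using s by (simp add: field_simps)
  have less: "2 * i < n" "2 * j < n" using ij by auto
  note U = core_U_pair[folded s_def]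
  have "core_map_complex n \<theta> M $$ (2 * i + p, 2 * j + q) =
    (\<Sum>b<2. \<Sum>a<2. s * pair_coeff p a *
       ((\<Sum>d<2. \<Sum>c<2.
           cnj (s * pair_coeff c a) * M $$ (2 * i + c, 2 * j + d) * (s * pair_coeff d b))
         * core_Phi n \<theta> $$ (2 * i + a, 2 * j + b)) * cnj (s * pair_coeff q b))"
    using ij pq core_map_complex_block[OF M less, of p q \<theta>] by (simp add: group_size_full U)
  then show ?thesis
    by (simp only: inner outer flip: sum_divide_distrib)
qed

lemma sum_lessThan_2: "(\<Sum>a<2. f a) = f 0 + f (Suc 0)" for f :: "nat \<Rightarrow> 'a :: comm_monoid_add"
  by (simp add: numeral_2_eq_2)

lemma core_map_index:
  assumes "p < n" "q < n"
  shows "core_map n \<theta> M $$ (p, q) = Re (core_map_complex n \<theta> (map_mat complex_of_real M) $$ (p, q))"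
  using assms core_map_complex_carrier[of n \<theta> "map_mat complex_of_real M"]
  by (auto simp: core_map_def)

text \<open>The eigenvalues of a complete group are a conjugate pair, so the entries of
  \<open>core_Phi\<close> in the block are P and its conjugate on the diagonal and Q and its
  conjugate off it. The parameters of \<open>mat_X\<close> are those of multiplication by the
  conjugates of P and Q. The case i = j, where P = 1, serves for the diagonal blocks.\<close>

lemma core_map_block_full:
  fixes \<theta> :: "real vec"
  assumes M: "M \<in> carrier_mat n n" and ij: "i < n div 2" "j < n div 2"
  defines "P \<equiv> expc (\<theta> $ i - \<theta> $ j)" and "Q \<equiv> expc (\<theta> $ i + \<theta> $ j)"
  shows "vec_of_mat (mat_block n (core_map n \<theta> M) i j) =
    mat_X (Re P) (- Im P) (Re Q) (- Im Q) *\<^sub>v vec_of_mat (mat_block n M i j)"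
proof -
  let ?M = "map_mat complex_of_real M"
  have less: "2 * i < n" "2 * j < n" "Suc (2 * i) < n" "Suc (2 * j) < n" using ij by auto
  have Phi: "core_Phi n \<theta> $$ (2 * i, 2 * j) = P"
    "core_Phi n \<theta> $$ (Suc (2 * i), Suc (2 * j)) = cnj P"
    "core_Phi n \<theta> $$ (2 * i, Suc (2 * j)) = Q"
    "core_Phi n \<theta> $$ (Suc (2 * i), 2 * j) = cnj Q"
    unfolding P_def Q_def cnj_expc
    using less ij by (auto intro!: core_Phi_expc simp only: core_eig_pair of_real_diff of_real_add of_real_minus)
 (simp_all add: algebra_simps)
  have M': "?M \<in> carrier_mat n n" using M by simp
  have Mi: "?M $$ (p, q) = complex_of_real (M $$ (p, q))" if "p < n" "q < n" for p q
    using that M by simp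
  define x y z w where "x = M $$ (2 * i, 2 * j)" and "y = M $$ (Suc (2 * i), 2 * j)"
    and "z = M $$ (2 * i, Suc (2 * j))" and "w = M $$ (Suc (2 * i), Suc (2 * j))"
  note E = core_map_complex_pair[OF M' ij, of _ _ \<theta>]
  have "core_map n \<theta> M $$ (2 * i, 2 * j) = ((Re P + Re Q) * x - (- Im P - Im Q) * y
      + (- Im P + Im Q) * z + (Re P - Re Q) * w) / 2"
    using arg_cong[OF E[of 0 0], of Re] less
    by (simp add: core_map_index sum_lessThan_2 pair_coeff_def Phi Mi
        flip: x_def y_def z_def w_def) (simp add: field_simps)
  moreover have "core_map n \<theta> M $$ (Suc (2 * i), 2 * j) = ((- Im P - Im Q) * x + (Re P + Re Q) * y
      + (Re Q - Re P) * z + (- Im P + Im Q) * w) / 2"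
    using arg_cong[OF E[of 1 0], of Re] less
    by (simp add: core_map_index sum_lessThan_2 pair_coeff_def Phi Mi
        flip: x_def y_def z_def w_def) (simp add: field_simps)
  moreover have "core_map n \<theta> M $$ (2 * i, Suc (2 * j)) = ((Im P - Im Q) * x + (Re Q - Re P) * y
      + (Re P + Re Q) * z - (- Im P - Im Q) * w) / 2"
    using arg_cong[OF E[of 0 1], of Re] less
    by (simp add: core_map_index sum_lessThan_2 pair_coeff_def Phi Mi
        flip: x_def y_def z_def w_def) (simp add: field_simps)
  moreover have "core_map n \<theta> M $$ (Suc (2 * i), Suc (2 * j)) = ((Re P - Re Q) * x + (Im P - Im Q) * y
      + (- Im P - Im Q) * z + (Re P + Re Q) * w) / 2"
    using arg_cong[OF E[of 1 1], of Re] less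
    by (simp add: core_map_index sum_lessThan_2 pair_coeff_def Phi Mi
        flip: x_def y_def z_def w_def) (simp add: field_simps)
  ultimately show ?thesis
    unfolding vec_of_mat_block_full[OF ij] mat_X_mult_vec by (simp flip: x_def y_def z_def w_def)
qed

text \<open>The last index has eigenvalue 0, so only one angle enters and the 1x2 block is a single
  complex line, multiplied by the conjugate of R.\<close>

lemma core_map_block_last:
  fixes \<theta> :: "real vec"
  assumes M: "M \<in> carrier_mat n n" and n: "odd n" and j: "j < n div 2"
  defines "R \<equiv> expc (\<theta> $ j)"
  shows "vec_of_mat (mat_block n (core_map n \<theta> M) (n div 2) j) =
    mat_Y (Re R) (- Im R) *\<^sub>v vec_of_mat (mat_block n M (n div 2) j)"
proof -
  let ?M = "map_mat complex_of_real M"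
  define l where "l = 2 * (n div 2)"
  have less: "l < n" "2 * j < n" "Suc (2 * j) < n" using n j by (auto simp: l_def elim: oddE)
  have eig0: "core_eig n \<theta> l = 0" by (simp add: core_eig_def l_def)
  have Phi: "core_Phi n \<theta> $$ (l, 2 * j) = cnj R" "core_Phi n \<theta> $$ (l, Suc (2 * j)) = R"
    unfolding R_def cnj_expc using less j
    by (auto intro!: core_Phi_expc simp only: core_eig_pair eig0) (simp_all add: algebra_simps)
  have M': "?M \<in> carrier_mat n n" using M by simp
  have Mi: "?M $$ (p, q) = complex_of_real (M $$ (p, q))" if "p < n" "q < n" for p q
    using that M by simp
  define x y where "x = M $$ (l, 2 * j)" and "y = M $$ (l, Suc (2 * j))"
  define s where "s = complex_of_real (sqrt 2 / 2)"
  have s: "s * s = 1 / 2" "cnj s = s" unfolding s_def by (rule sqrt2_half_squared) simp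
  have U1: "core_U n $$ (l, l) = 1" using less(1) by (simp add: core_U_index l_def)
  \<comment> \<open>Only the column group carries the factor s, since the last diagonal entry of
    \<open>core_U n\<close> is 1; the two copies of s give 1 / 2.\<close>
  have outer: "(a * (s * b) + c * (s * d)) * f * (s * g) = (a * b + c * d) * f * g / 2" for a b c d f g
  proof -
    have "(a * (s * b) + c * (s * d)) * f * (s * g) = (s * s) * ((a * b + c * d) * f * g)"
      by (simp add: algebra_simps)
    then show ?thesis unfolding s by simp
  qed
  have E: "core_map_complex n \<theta> ?M $$ (l, 2 * j + q) =
    (\<Sum>b<2. (of_real x * pair_coeff 0 b + of_real y * pair_coeff (Suc 0) b)
      * core_Phi n \<theta> $$ (l, 2 * j + b) * cnj (pair_coeff q b) / 2)" if q: "q < 2" for q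
  proof -
    have "core_map_complex n \<theta> ?M $$ (l, 2 * j + q) =
      (\<Sum>b<2. (\<Sum>d<2. ?M $$ (l, 2 * j + d) * (s * pair_coeff d b))
         * core_Phi n \<theta> $$ (l, 2 * j + b) * (s * cnj (pair_coeff q b)))"
      using q core_map_complex_block[OF M' less(1)[unfolded l_def] less(2), of 0 q \<theta>,
          unfolded group_size_last[OF n] group_size_full[OF j], folded l_def]
      by (simp add: core_U_pair[OF j, folded s_def] U1 s)
    then show ?thesis
      by (simp only: sum_lessThan_2 add_0_right add_Suc_right outer
          Mi[OF less(1,2)] Mi[OF less(1,3)] flip: x_def y_def)
  qed
  have "core_map n \<theta> M $$ (l, 2 * j) = Re R * x - - Im R * y"
    using less arg_cong[OF E[of 0], of Re]
    by (simp add: core_map_index sum_lessThan_2 pair_coeff_def Phi; simp add: field_simps)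
  moreover have "core_map n \<theta> M $$ (l, Suc (2 * j)) = - Im R * x + Re R * y"
    using less arg_cong[OF E[of 1], of Re]
    by (simp add: core_map_index sum_lessThan_2 pair_coeff_def Phi; simp add: field_simps)
  ultimately show ?thesis
    unfolding vec_of_mat_block_last[OF n j] mat_Y_mult_vec l_def[symmetric]
    by (simp flip: x_def y_def)
qed

section \<open>Skew-symmetry and the diagonal blocks\<close>

lemma SkewD:
  assumes "M \<in> Skew n"
  shows "M \<in> carrier_mat n n" "p < n \<Longrightarrow> q < n \<Longrightarrow> M $$ (q, p) = - M $$ (p, q)"
    "p < n \<Longrightarrow> M $$ (p, p) = 0"
proof -
  show 1: "M \<in> carrier_mat n n" "p < n \<Longrightarrow> q < n \<Longrightarrow> M $$ (q, p) = - M $$ (p, q)" for q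
    using assms unfolding Skew_iff by blast+
  show "p < n \<Longrightarrow> M $$ (p, p) = 0" using 1(2)[of p] by simp
qed

lemma mat_block_Skew_transpose:
  assumes "M \<in> Skew n" "2 * i < n" "2 * j < n"
  shows "transpose_mat (mat_block n M i j) = - 1 \<cdot>\<^sub>m mat_block n M j i"
  using assms by (intro eq_matI) (auto simp: mat_block_def group_size_def intro!: SkewD(2))

lemma mat_block_carrier [simp]: "mat_block n M i j \<in> carrier_mat (group_size n i) (group_size n j)"
  by (simp add: mat_block_def)

text \<open>A skew-symmetric 2x2 block is a multiple of J, so it lies in the commuting part, where
  the multiplier is \<open>expc 0 = 1\<close>. Skew-symmetry of both sides reduces the check to the
  lower left entry. A 1x1 block is zero on both sides.\<close>

lemma core_map_block_diag:
  assumes M: "M \<in> Skew n" and i: "2 * i < n"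
  shows "mat_block n (core_map n \<theta> M) i i = mat_block n M i i"
proof (cases "i < n div 2")
  case True
  note S = SkewD[OF M] SkewD(2,3)[OF core_map_Skew[OF M, of \<theta>]]
  have less: "2 * i < n" "Suc (2 * i) < n" using True by auto
  have "core_map n \<theta> M $$ (Suc (2 * i), 2 * i) = M $$ (Suc (2 * i), 2 * i)"
    using core_map_block_full[OF S(1) True True, of \<theta>,
        unfolded vec_of_mat_block_full[OF True True] mat_X_mult_vec]
      S(2)[of "2 * i" "Suc (2 * i)"] less
    by (simp add: S(3) expc_def[of 0] field_simps)
  then show ?thesis
    using less S(2)[of "2 * i" "Suc (2 * i)"] S(4)[of "2 * i" "Suc (2 * i)"]
    by (intro eq_matI) (auto simp: mat_block_def group_size_full[OF True] less_2_cases_iff S(3,5))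
next
  case False
  then have "group_size n i = 1" using i by (auto simp: group_size_def)
  then show ?thesis
    using i SkewD(3)[OF M] SkewD(3)[OF core_map_Skew[OF M, of \<theta>]]
    by (intro eq_matI) (auto simp: mat_block_def)
qed

section \<open>Undoing vectorisation, and linearity of maps on blocks\<close>

definition mat_of_vec :: "nat \<Rightarrow> nat \<Rightarrow> 'a vec \<Rightarrow> 'a mat" where
  "mat_of_vec r c v = mat r c (\<lambda>(p, q). v $ (q * r + p))"

lemma mat_of_vec_carrier [simp]: "mat_of_vec r c v \<in> carrier_mat r c"
  by (simp add: mat_of_vec_def)

lemma vec_of_mat_carrier: "A \<in> carrier_mat r c \<Longrightarrow> vec_of_mat A \<in> carrier_vec (r * c)"
  by (auto simp: vec_of_mat_def)

lemma mat_of_vec_index_less: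
  fixes p q r c :: nat
  assumes "p < r" "q < c" shows "q * r + p < r * c"
proof -
  have "q * r + p < (q + 1) * r" using assms by simp
  also have "\<dots> \<le> c * r" using assms by (intro mult_right_mono) auto
  finally show ?thesis by (simp add: mult.commute)
qed

lemma vec_of_mat_of_vec:
  assumes "v \<in> carrier_vec (r * c)"
  shows "vec_of_mat (mat_of_vec r c v) = v"
proof (rule eq_vecI)
  fix l assume "l < dim_vec v"
  then have l: "l < r * c" using assms by simp
  then have "l mod r < r" by (metis mod_less_divisor mult_zero_left neq0_conv not_less_zero)
  moreover have "l div r < c" using l by (simp add: less_mult_imp_div_less mult.commute)
  ultimately show "vec_of_mat (mat_of_vec r c v) $ l = v $ l"
    using l by (simp add: vec_of_mat_def mat_of_vec_def)
qed (use assms in \<open>simp add: vec_of_mat_def mat_of_vec_def\<close>)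

lemma mat_of_vec_of_mat:
  assumes "A \<in> carrier_mat r c"
  shows "mat_of_vec r c (vec_of_mat A) = A"
  using assms
  by (intro eq_matI) (auto simp: vec_of_mat_def mat_of_vec_def mat_of_vec_index_less)

lemma linear_mat_map_vec_of_mat:
  assumes T: "T \<in> carrier_mat (r * c) (r * c)"
  shows "linear_mat_map r c (\<lambda>A. mat_of_vec r c (T *\<^sub>v vec_of_mat A))"
proof -
  have div: "l mod r < r \<and> l div r < c" if "l < r * c" for l
    using that
    by (metis less_mult_imp_div_less mod_less_divisor mult.commute mult_zero_left neq0_conv not_less_zero)
  have add: "vec_of_mat (A + B) = vec_of_mat A + vec_of_mat B"
    if "A \<in> carrier_mat r c" "B \<in> carrier_mat r c" for A B :: "real mat"
    using that div by (intro eq_vecI) (auto simp: vec_of_mat_def)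
  have smult: "vec_of_mat (x \<cdot>\<^sub>m A) = x \<cdot>\<^sub>v vec_of_mat A" if "A \<in> carrier_mat r c" for A :: "real mat" and x
    using that div by (intro eq_vecI) (auto simp: vec_of_mat_def)
  have add': "mat_of_vec r c (v + w) = mat_of_vec r c v + mat_of_vec r c w"
    if "w \<in> carrier_vec (r * c)" for v w :: "real vec"
    using that by (intro eq_matI) (auto simp: mat_of_vec_def mat_of_vec_index_less)
  have smult': "mat_of_vec r c (x \<cdot>\<^sub>v v) = x \<cdot>\<^sub>m mat_of_vec r c v"
    if "v \<in> carrier_vec (r * c)" for x and v :: "real vec"
    using that by (intro eq_matI) (auto simp: mat_of_vec_def mat_of_vec_index_less)
  show ?thesis
    unfolding linear_mat_map_def
    using T by (auto simp: add smult add' smult' vec_of_mat_carrier mult_add_distrib_mat_vec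
        mult_mat_vec[OF T])
qed

text \<open>This serves the blocks above the diagonal, whose inverse is the one of the mirrored
  block conjugated by transposition.\<close>

lemma linear_mat_map_transpose:
  assumes "linear_mat_map r c f"
  shows "linear_mat_map c r (\<lambda>A. transpose_mat (f (transpose_mat A)))"
proof -
  have "transpose_mat (x \<cdot>\<^sub>m A) = x \<cdot>\<^sub>m transpose_mat A" for x and A :: "real mat"
    by (intro eq_matI) auto
  then show ?thesis
    using assms unfolding linear_mat_map_def
    by (auto simp: transpose_add[of _ c r] transpose_add[of _ r c])
qed

lemma mat_X_carrier [simp]: "mat_X a b c d \<in> carrier_mat 4 4"
  by (auto simp: mat_X_def mat_of_rows_list_def)

lemma mat_Y_carrier [simp]: "mat_Y r s \<in> carrier_mat 2 2"
  by (auto simp: mat_Y_def mat_of_rows_list_def)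

section \<open>Surjectivity puts the half angles into the domain of \<open>cotc\<close>\<close>

lemma ex_Skew_unit:
  assumes "p < n" "q < n" "p \<noteq> q"
  shows "\<exists>N \<in> Skew n. N $$ (p, q) = 1 \<and>
    (\<forall>a<n. \<forall>b<n. (a, b) \<notin> {(p, q), (q, p)} \<longrightarrow> N $$ (a, b) = 0)"
proof -
  let ?N = "mat n n (\<lambda>(a, b). if (a, b) = (p, q) then 1 else if (a, b) = (q, p) then - 1 else (0 :: real))"
  have "?N \<in> Skew n" using assms unfolding Skew_iff by auto
  then show ?thesis using assms by (intro bexI[of _ ?N]) auto
qed

text \<open>If P = 0, every image block has no commuting part, so its two diagonal entries are
  opposite; if Q = 0, it has no anticommuting part and they are equal. A skew-symmetric N whose
  block has diagonal entries 1 and 0 contradicts both.\<close>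

lemma core_map_surj_cotc_dom:
  assumes surj: "core_map n \<theta> ` Skew n = Skew n" and ij: "j < i" "i < n div 2"
  shows "(\<theta> $ i - \<theta> $ j) / 2 \<in> cotc_dom" "(\<theta> $ i + \<theta> $ j) / 2 \<in> cotc_dom"
proof -
  have less: "2 * i < n" "2 * j < n" "Suc (2 * i) < n" "Suc (2 * j) < n" and j: "j < n div 2"
    using ij by auto
  have ne: "2 * i \<noteq> 2 * j" using ij by simp
  obtain N where N: "N \<in> Skew n" and e1: "N $$ (2 * i, 2 * j) = 1"
    and z: "\<forall>a<n. \<forall>b<n. (a, b) \<notin> {(2 * i, 2 * j), (2 * j, 2 * i)} \<longrightarrow> N $$ (a, b) = 0"
    using ex_Skew_unit[OF less(1,2) ne] by (elim bexE conjE) (rule that)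
  have "N $$ (Suc (2 * i), Suc (2 * j)) = 0"
    using z less(3,4) by (simp add: Suc_double_not_eq_double)
  note e = e1 this
  have "N \<in> core_map n \<theta> ` Skew n" using N by (simp only: surj)
  then obtain M where M: "M \<in> Skew n" "core_map n \<theta> M = N" by blast
  note F = core_map_block_full[OF SkewD(1)[OF M(1)] ij(2) j, of \<theta>, unfolded M(2)
      vec_of_mat_block_full[OF ij(2) j] mat_X_mult_vec]
  show "(\<theta> $ i - \<theta> $ j) / 2 \<in> cotc_dom"
  proof (rule ccontr)
    assume "(\<theta> $ i - \<theta> $ j) / 2 \<notin> cotc_dom"
    from expc_eq_0[OF this] show False using F e by (simp add: algebra_simps)
  qed
  show "(\<theta> $ i + \<theta> $ j) / 2 \<in> cotc_dom"
  proof (rule ccontr)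
    assume "(\<theta> $ i + \<theta> $ j) / 2 \<notin> cotc_dom"
    from expc_eq_0[OF this] show False using F e by (simp add: algebra_simps)
  qed
qed

text \<open>Here a vanishing multiplier annihilates the whole 1x2 block, so one nonzero entry gives
  the contradiction.\<close>

lemma core_map_surj_cotc_dom_last:
  assumes surj: "core_map n \<theta> ` Skew n = Skew n" and n: "odd n" and j: "j < n div 2"
  shows "\<theta> $ j / 2 \<in> cotc_dom"
proof (rule ccontr)
  assume "\<theta> $ j / 2 \<notin> cotc_dom"
  note R = expc_eq_0[OF this]
  have less: "2 * (n div 2) < n" "2 * j < n" using n j by (auto elim: oddE)
  have ne: "2 * (n div 2) \<noteq> 2 * j" using j by linarith
  obtain N where N: "N \<in> Skew n" and e: "N $$ (2 * (n div 2), 2 * j) = 1"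
    using ex_Skew_unit[OF less ne] by (elim bexE conjE) (rule that)
  have "N \<in> core_map n \<theta> ` Skew n" using N by (simp only: surj)
  then obtain M where M: "M \<in> Skew n" "core_map n \<theta> M = N" by blast
  show False
    using core_map_block_last[OF SkewD(1)[OF M(1)] n j, of \<theta>, unfolded M(2)
      vec_of_mat_block_last[OF n j] mat_Y_mult_vec] R e by simp
qed

section \<open>The inverse on the blocks below the diagonal\<close>

definition inv_block_mat :: "nat \<Rightarrow> real vec \<Rightarrow> nat \<Rightarrow> nat \<Rightarrow> real mat" where
  "inv_block_mat n \<theta> i j =
    (if i < n div 2
     then mat_X (cotc ((\<theta> $ i - \<theta> $ j) / 2)) ((\<theta> $ i - \<theta> $ j) / 2)
                (cotc ((\<theta> $ i + \<theta> $ j) / 2)) ((\<theta> $ i + \<theta> $ j) / 2)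
     else mat_Y (cotc (\<theta> $ j / 2)) (\<theta> $ j / 2))"

definition inv_block :: "nat \<Rightarrow> real vec \<Rightarrow> nat \<Rightarrow> nat \<Rightarrow> real mat \<Rightarrow> real mat" where
  "inv_block n \<theta> i j A =
     mat_of_vec (group_size n i) (group_size n j) (inv_block_mat n \<theta> i j *\<^sub>v vec_of_mat A)"

text \<open>For j < i the column group is complete, and the row group is complete unless it is the
  last index of an odd n. So the block has 4 or 2 entries, matching \<open>mat_X\<close> and
  \<open>mat_Y\<close>.\<close>

lemma inv_block_mat_carrier:
  assumes "j < i" "2 * i < n"
  shows "inv_block_mat n \<theta> i j \<in>
    carrier_mat (group_size n i * group_size n j) (group_size n i * group_size n j)"
proof -
  have "group_size n j = 2" "group_size n i = (if i < n div 2 then 2 else 1)"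
    using assms by (auto simp: group_size_def)
  then show ?thesis by (simp add: inv_block_mat_def)
qed

text \<open>The blocks are multiplied by the conjugate of \<open>expc\<close>, so the reciprocal is
  conjugated too. This is why the half angles enter the inverse with a plus sign.\<close>

lemma cnj_expc_inverse:
  assumes "y / 2 \<in> cotc_dom"
  shows "Complex (cotc (y / 2)) (y / 2) * Complex (Re (expc y)) (- Im (expc y)) = 1"
  using arg_cong[OF expc_inverse[OF assms], of cnj] by (simp add: complex_eq_iff algebra_simps)

text \<open>A left inverse is enough: bijectivity supplies a preimage M of every N, and this
  recovers the blocks of M from those of N.\<close>

lemma inv_block_core_map:
  assumes M: "M \<in> Skew n" and surj: "core_map n \<theta> ` Skew n = Skew n" and ij: "j < i" "2 * i < n"
  shows "mat_block n M i j = inv_block n \<theta> i j (mat_block n (core_map n \<theta> M) i j)"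
proof -
  have "inv_block_mat n \<theta> i j *\<^sub>v vec_of_mat (mat_block n (core_map n \<theta> M) i j) =
    vec_of_mat (mat_block n M i j)"
  proof (cases "i < n div 2")
    case True
    then have j: "j < n div 2" using ij by simp
    show ?thesis
      using True core_map_surj_cotc_dom[OF surj ij(1) True]
      by (simp add: inv_block_mat_def core_map_block_full[OF SkewD(1)[OF M] True j]
          mat_X_inverse[OF cnj_expc_inverse cnj_expc_inverse vec_of_mat_block_full[OF True j]])
  next
    case False
    then have i: "i = n div 2" and n: "odd n" and j: "j < n div 2" using ij by presburger+
    show ?thesis
      using core_map_surj_cotc_dom_last[OF surj n j] unfolding i
      by (simp add: inv_block_mat_def core_map_block_last[OF SkewD(1)[OF M] n j]
          mat_Y_inverse[OF cnj_expc_inverse vec_of_mat_block_last[OF n j]])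
  qed
  then show ?thesis by (simp add: inv_block_def mat_of_vec_of_mat)
qed

section \<open>Assembling the inverse from its blocks\<close>

theorem proposition3p7:
  fixes n m k :: nat and \<theta> :: "real vec"
  defines "m \<equiv> n div 2" and "k \<equiv> (n + 1) div 2"
  assumes "n \<ge> 2"
    and "\<theta> \<in> carrier_vec m"
    and invertible: "bij_betw (core_map n \<theta>) (Skew n) (Skew n)"
  shows "(\<forall>i<m. \<forall>j<i. (\<theta> $ i - \<theta> $ j) / 2 \<in> cotc_dom \<and> (\<theta> $ i + \<theta> $ j) / 2 \<in> cotc_dom) \<and>
    (odd n \<longrightarrow> (\<forall>j<m. \<theta> $ j / 2 \<in> cotc_dom)) \<and>
    (\<exists>L :: nat \<Rightarrow> nat \<Rightarrow> real mat \<Rightarrow> real mat.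
      (\<forall>i<k. \<forall>j<k. linear_mat_map (group_size n i) (group_size n j) (L i j)) \<and>
      (\<forall>N \<in> Skew n.
        (\<forall>i<k. \<forall>j<k.
          mat_block n (the_inv_into (Skew n) (core_map n \<theta>) N) i j = L i j (mat_block n N i j)) \<and>
        (\<forall>i<k. vec_of_mat (L i i (mat_block n N i i)) = vec_of_mat (mat_block n N i i)) \<and>
        (\<forall>i<m. \<forall>j<i.
          vec_of_mat (L i j (mat_block n N i j)) =
            mat_X (cotc ((\<theta> $ i - \<theta> $ j) / 2)) ((\<theta> $ i - \<theta> $ j) / 2)
                  (cotc ((\<theta> $ i + \<theta> $ j) / 2)) ((\<theta> $ i + \<theta> $ j) / 2)
              *\<^sub>v vec_of_mat (mat_block n N i j)) \<and>
        (odd n \<longrightarrow>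
          (\<forall>j<m. vec_of_mat (L m j (mat_block n N m j)) =
            mat_Y (cotc (\<theta> $ j / 2)) (\<theta> $ j / 2) *\<^sub>v vec_of_mat (mat_block n N m j)) \<and>
          L m m (mat_block n N m m) = 0\<^sub>m 1 1)))"
proof -
  let ?C = "core_map n \<theta>" and ?Cinv = "the_inv_into (Skew n) (core_map n \<theta>)"
  have surj: "?C ` Skew n = Skew n" and inj: "inj_on ?C (Skew n)"
    using invertible by (auto simp: bij_betw_def)
  have lt: "2 * i < n" if "i < k" for i using that by (auto simp: k_def)
  have mk: "m \<le> k" by (simp add: m_def k_def)
  \<comment> \<open>Above the diagonal, block (i, j) of M is minus the transpose of block (j, i),
    and likewise for N. By linearity the two signs cancel, so only the transpositions around the
    lower map remain.\<close>
  define L where "L = (\<lambda>i j A. if i = j then A else if j < i then inv_block n \<theta> i j A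
    else transpose_mat (inv_block n \<theta> j i (transpose_mat A)))"
  have lin: "linear_mat_map (group_size n i) (group_size n j) (inv_block n \<theta> i j)"
    if "j < i" "i < k" for i j
    unfolding inv_block_def
    using that by (intro linear_mat_map_vec_of_mat inv_block_mat_carrier lt)
  have linL: "linear_mat_map (group_size n i) (group_size n j) (L i j)" if "i < k" "j < k" for i j
  proof (cases i j rule: linorder_cases)
    case less
    then show ?thesis using linear_mat_map_transpose[OF lin[OF less]] that by (simp add: L_def)
  next
    case equal
    then show ?thesis by (simp add: L_def linear_mat_map_def)
  next
    case greater
    then show ?thesis using lin[OF greater] that by (simp add: L_def)
  qed
  have vecL: "vec_of_mat (L i j (mat_block n N i j)) =
      inv_block_mat n \<theta> i j *\<^sub>v vec_of_mat (mat_block n N i j)" if "j < i" "i < k" for i j N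
    using that vec_of_mat_of_vec[OF mult_mat_vec_carrier[OF
        inv_block_mat_carrier[OF that(1) lt[OF that(2)]] vec_of_mat_carrier[OF mat_block_carrier]]]
    by (simp add: L_def inv_block_def)
  have block: "mat_block n (?Cinv N) i j = L i j (mat_block n N i j)"
    if N: "N \<in> Skew n" and ij: "i < k" "j < k" for N i j
  proof -
    define M where "M = ?Cinv N"
    have M: "M \<in> Skew n" and CM: "?C M = N"
      unfolding M_def using N surj the_inv_into_into[OF inj] f_the_inv_into_f[OF inj] by auto
    show ?thesis unfolding M_def[symmetric]
    proof (cases i j rule: linorder_cases)
      case less
      let ?B = "mat_block n N j i"
      have "transpose_mat (mat_block n M i j) = - 1 \<cdot>\<^sub>m inv_block n \<theta> j i ?B"
        using inv_block_core_map[OF M surj less lt[OF ij(2)]] mat_block_Skew_transpose[OF M lt lt, OF ij]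
        by (simp add: CM)
      \<comment> \<open>Linearity carries the sign inward, where skew-symmetry of N absorbs it into
        a transpose.\<close>
      also have "\<dots> = inv_block n \<theta> j i (- 1 \<cdot>\<^sub>m ?B)"
        using lin[OF less ij(2)] unfolding linear_mat_map_def by (metis mat_block_carrier)
      also have "- 1 \<cdot>\<^sub>m ?B = transpose_mat (mat_block n N i j)"
        using mat_block_Skew_transpose[OF N lt lt, OF ij] by simp
      finally show "mat_block n M i j = L i j (mat_block n N i j)"
        using less by (simp add: L_def) (metis transpose_transpose)
    next
      case equal
      then show "mat_block n M i j = L i j (mat_block n N i j)"
        using core_map_block_diag[OF M lt[OF ij(1)], of \<theta>] by (simp add: L_def CM)
    next
      case greater
      then show "mat_block n M i j = L i j (mat_block n N i j)"
        using inv_block_core_map[OF M surj greater lt[OF ij(1)]] by (simp add: L_def CM)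
    qed
  qed
  \<comment> \<open>On this 1x1 block L is the identity; the value 0 comes from the zero diagonal of
    N.\<close>
  have zero: "L m m (mat_block n N m m) = 0\<^sub>m 1 1" if "N \<in> Skew n" "odd n" for N
    using SkewD(3)[OF that(1)] that(2) group_size_last[OF that(2)]
    by (intro eq_matI) (auto simp: L_def mat_block_def m_def elim: oddE)
  show ?thesis
  proof (intro conjI exI[of _ L] ballI allI impI)
    show "(\<theta> $ i - \<theta> $ j) / 2 \<in> cotc_dom" "(\<theta> $ i + \<theta> $ j) / 2 \<in> cotc_dom"
      if "i < m" "j < i" for i j
      using core_map_surj_cotc_dom[OF surj] that by (auto simp: m_def)
    show "\<theta> $ j / 2 \<in> cotc_dom" if "odd n" "j < m" for j
      using core_map_surj_cotc_dom_last[OF surj] that by (auto simp: m_def)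
    show "vec_of_mat (L i i (mat_block n N i i)) = vec_of_mat (mat_block n N i i)" for N i
      by (simp add: L_def)
    show "vec_of_mat (L i j (mat_block n N i j)) =
            mat_X (cotc ((\<theta> $ i - \<theta> $ j) / 2)) ((\<theta> $ i - \<theta> $ j) / 2)
                  (cotc ((\<theta> $ i + \<theta> $ j) / 2)) ((\<theta> $ i + \<theta> $ j) / 2)
              *\<^sub>v vec_of_mat (mat_block n N i j)" if "i < m" "j < i" for i j N
      using vecL[OF that(2), of N] that mk by (simp add: inv_block_mat_def m_def)
    show "vec_of_mat (L m j (mat_block n N m j)) =
            mat_Y (cotc (\<theta> $ j / 2)) (\<theta> $ j / 2) *\<^sub>v vec_of_mat (mat_block n N m j)"
      if "odd n" "j < m" for j N
      using vecL[OF that(2), of N] that by (auto simp: inv_block_mat_def m_def k_def elim: oddE)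
  qed (use linL block zero in auto)
qed

end
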